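(* Let $\mathcal{P}_A,\mathcal{P}_B\in(0,1)$ and let $\mathcal{G}_A=G(\mathcal{P}_A)$, $\mathcal{G}_B=G(\mathcal{P}_B)$ be the corresponding probabilities that $A$, respectively $B$, wins a game on own serve. Let $H$ denote the number of games won by $A$ minus the number of games won by $B$ in a set, let $S\in\{A,B\}$ be the first server of the set, and write $H^{\mathrm{set}}_A=\mathbb{E}(H\mid S=A)$ and $H^{\mathrm{set}}_B=\mathbb{E}(H\mid S=B)$. Assume that $\mathcal{G}_A+\mathcal{G}_B>1$. Then $H^{\mathrm{set}}_A>H^{\mathrm{set}}_B$.
   Context: Tennis model with constant serve-point probabilities. Two players $A,B$ play. Each point is won by the player $\sigma\in\{A,B\}$ serving it with probability $\mathcal{P}_\sigma$, independently of all other points. A (non-tiebreak) game served by $\sigma$ is won by $\sigma$ with probability $\mathcal{G}_\sigma=G(\mathcal{P}_\sigma)$, where $$G(x)=x^4\left(15-4x-\frac{10x^2}{1-2x(1-x)}\right),$$ and distinct games are independent. Set: the players alternate serving games, starting with the first server of the set. The set is won by the first player to have won at least 6 games with a lead of at least 2 games; if the score reaches 6-6 a tiebreak is played, which decides the set (final score 7-6) and counts as one game (the 13th), won by the tiebreak winner. Hence the possible final scores are 6-0, 6-1, 6-2, 6-3, 6-4, 7-5, 7-6 in favour of either player, and the total number of games is the sum of the two numbers in the score. Tiebreak: the first server of the set serves the first point of the tiebreak; then the opponent serves two points, then the first server two points, and so on alternately in blocks of two; the tiebreak is won by the first player with at least 7 points and a lead of at least 2 points. Here $\mathbb{E}(\,\cdot\mid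 S=\sigma)$ means the expectation in the model for a set whose first server is $\sigma$. *)

theory Defs
  imports "HOL-Probability.Probability"
begin

datatype player = PlayerA | PlayerB

fun opponent :: "player \<Rightarrow> player" where
  "opponent PlayerA = PlayerB"
| "opponent PlayerB = PlayerA"

text \<open>The probability that the server wins a game when he wins each point with probability x.
  It lies between 0 and 1 for x strictly between 0 and 1, so that the truncation of its argument to
  the unit interval in bernoulli_pmf never takes effect below.\<close>

definition game_prob :: "real \<Rightarrow> real" where
  "game_prob x = x ^ 4 * (15 - 4 * x - 10 * x ^ 2 / (1 - 2 * x * (1 - x)))"

definition winner_pmf :: "player \<Rightarrow> real \<Rightarrow> player pmf" where
  "winner_pmf s p = map_pmf (\<lambda>b. if b then s else opponent s) (bernoulli_pmf p)"

text \<open>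
  Games and points are numbered from 0, so that game 12 is the tiebreak. For the first server s
  of the set, the points of the tiebreak are served by s, s', s', s, s, s', s', s, s, and so on,
  where s' is the opponent of s.
\<close>

definition game_server :: "player \<Rightarrow> nat \<Rightarrow> player" where
  "game_server s i = (if even i then s else opponent s)"

definition tiebreak_server :: "player \<Rightarrow> nat \<Rightarrow> player" where
  "tiebreak_server s j = (if even ((j + 1) div 2) then s else opponent s)"

text \<open>
  An outcome consists of the winners of the games 0 to 11 and of the winners of the points of the
  tiebreak, all independent. Games after the end of the set and points after the end of the
  tiebreak are also drawn, but they have no influence on the result.
\<close>

type_synonym outcome = "(nat \<Rightarrow> player) \<times> (nat \<Rightarrow> player)"

definition set_model :: "(player \<Rightarrow> real) \<Rightarrow> player \<Rightarrow> outcome measure" where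
  "set_model P s =
     (\<Pi>\<^sub>M i\<in>{..<12}. measure_pmf (winner_pmf (game_server s i) (game_prob (P (game_server s i)))))
     \<Otimes>\<^sub>M
     (\<Pi>\<^sub>M j\<in>UNIV. measure_pmf (winner_pmf (tiebreak_server s j) (P (tiebreak_server s j))))"

definition score :: "(nat \<Rightarrow> player) \<Rightarrow> player \<Rightarrow> nat \<Rightarrow> nat" where
  "score w p n = card {i. i < n \<and> w i = p}"

definition tiebreak_won_at :: "(nat \<Rightarrow> player) \<Rightarrow> player \<Rightarrow> nat \<Rightarrow> bool" where
  "tiebreak_won_at v p n \<longleftrightarrow> score v p n \<ge> 7 \<and> score v p n \<ge> score v (opponent p) n + 2"

definition wins_tiebreak :: "(nat \<Rightarrow> player) \<Rightarrow> player \<Rightarrow> bool" where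
  "wins_tiebreak v p \<longleftrightarrow>
     (\<exists>n. tiebreak_won_at v p n \<and> (\<forall>m<n. \<not> tiebreak_won_at v (opponent p) m))"

text \<open>
  A tiebreak that never ends, which has probability 0 if the point probabilities lie strictly
  between 0 and 1, is counted for player B to make the winner a total function.
\<close>

definition game_winner :: "outcome \<Rightarrow> nat \<Rightarrow> player" where
  "game_winner \<omega> i =
     (if i < 12 then fst \<omega> i
      else if wins_tiebreak (snd \<omega>) PlayerA then PlayerA else PlayerB)"

text \<open>The scores 7-6 and 6-7 can only arise from a tiebreak at 6-6.\<close>

definition set_over :: "nat \<Rightarrow> nat \<Rightarrow> bool" where
  "set_over a b \<longleftrightarrow>
     a \<ge> 6 \<and> a \<ge> b + 2 \<or> b \<ge> 6 \<and> b \<ge> a + 2 \<or> a = 7 \<and> b = 6 \<or> a = 6 \<and> b = 7"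

definition set_length :: "outcome \<Rightarrow> nat" where
  "set_length \<omega> =
     (LEAST n. set_over (score (game_winner \<omega>) PlayerA n) (score (game_winner \<omega>) PlayerB n))"

definition game_difference :: "outcome \<Rightarrow> real" where
  "game_difference \<omega> =
     real (score (game_winner \<omega>) PlayerA (set_length \<omega>)) -
     real (score (game_winner \<omega>) PlayerB (set_length \<omega>))"

definition H_set :: "(player \<Rightarrow> real) \<Rightarrow> player \<Rightarrow> real" where
  "H_set P s = integral\<^sup>L (set_model P s) game_difference"

end

theory Submission imports Defs begin

text \<open>
  The two sets, with A serving first and with B serving first, are compared by a coupling: the
  games of the second set are those of the first with the two games of every pair (0, 1), (2, 3),
  and so on exchanged, and likewise for the points of the tiebreak. In each pair each player serves
  once, so the exchange turns the law of one model into the law of the other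
  (\<open>set_model_opponent\<close>). The exchange does not change the score after an even number of games or
  points. Both a set before its tiebreak and a tiebreak, when decided after an odd number of
  steps, are decided with such a lead that the next step does not matter any more. Hence the
  exchange does not change the winner of the tiebreak (\<open>wins_tiebreak_swap\<close>), nor the pair of games
  in which the set ends. The only effect is on whether the second game of the last pair is played.

  This matters only at 5-1, 5-3, 1-5 and 3-5. There, if the two games of the next pair are won by
  different players, the set stops after the first of them in one of the two orders and continues
  to the second in the other one, and in each of the four scores the order in which A wins the first
  game has a difference in games that is larger by 1. Therefore (\<open>game_difference_swap\<close>)
  the game difference minus that after the exchange is the sum, over the pairs starting at one of
  these scores, of 1 if A wins the first game, minus 1 if A wins the second game. Earlier
  games are independent of the pair, so each such pair contributes in expectation its probability to
  occur at one of these scores times \<open>G\<^sub>A - (1 - G\<^sub>B)\<close>. This factor is positive by hypothesis,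
  and the score 5-1 has positive probability because \<open>G\<^sub>A\<close> and \<open>G\<^sub>B\<close> lie strictly between 0 and 1.
\<close>

section \<open>Scores and the exchange of consecutive games\<close>

definition partner :: "nat \<Rightarrow> nat" where
  "partner i = (if even i then i + 1 else i - 1)"

lemma partner_even [simp]: "partner (2 * k) = 2 * k + 1"
  and partner_odd [simp]: "partner (Suc (2 * k)) = 2 * k"
  by (simp_all add: partner_def)

lemma inj_partner: "inj partner"
  by (rule injI) (simp add: partner_def split: if_splits; presburger)

lemma partner_less_even: "i < 2 * k \<Longrightarrow> partner i < 2 * k"
  by (auto simp: partner_def elim!: evenE)

lemma opponent_cases: "x = p \<or> x = opponent p"
  by (cases x; cases p) auto

lemma opponent_neq [simp]: "opponent p \<noteq> p" "p \<noteq> opponent p"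
  by (cases p; simp)+

lemma opponent_opponent [simp]: "opponent (opponent p) = p"
  by (cases p) auto

lemma score_0 [simp]: "score w p 0 = 0"
  by (simp add: score_def)

lemma score_Suc: "score w p (Suc n) = score w p n + of_bool (w n = p)"
proof -
  have "{i. i < Suc n \<and> w i = p} = (if w n = p then insert n {i. i < n \<and> w i = p} else {i. i < n \<and> w i = p})"
    by (auto simp: less_Suc_eq)
  then show ?thesis by (simp add: score_def)
qed

lemma score_eq_sum: "score w p n = (\<Sum>i<n. of_bool (w i = p))"
  by (induction n) (simp_all add: score_Suc)

lemma score_total: "score w p n + score w (opponent p) n = n"
proof (induction n)
  case (Suc n)
  then show ?case using opponent_cases[of "w n" p] by (auto simp: score_Suc)
qed simp

lemma score_total_AB: "score w PlayerA n + score w PlayerB n = n"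
  using score_total[of w PlayerA n] by simp

lemma score_mono: "m \<le> n \<Longrightarrow> score w p m \<le> score w p n"
  by (auto simp: score_def intro!: card_mono)

lemma score_cong: "(\<And>i. i < n \<Longrightarrow> w i = w' i) \<Longrightarrow> score w p n = score w' p n"
  by (simp add: score_eq_sum)

lemma score_swap:
  assumes "\<And>i. i < 2 * k \<Longrightarrow> w' i = w (partner i)"
  shows "score w' p (2 * k) = score w p (2 * k)"
  using assms by (induction k) (simp_all add: score_Suc)

section \<open>The winner of the tiebreak\<close>

text \<open>After an odd number of points the lead is odd, so a lead of at least 2 is one of at least 3,
  which survives the loss of a point.\<close>

lemma tiebreak_won_at_Suc_if_odd:
  assumes "tiebreak_won_at v p n" "odd n"
  shows "tiebreak_won_at v p (Suc n)"
proof -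
  have "score v p n \<noteq> score v (opponent p) n + 2"
    using score_total[of v p n] assms(2) by presburger
  then show ?thesis using assms(1)
    by (auto simp: tiebreak_won_at_def score_Suc)
qed

text \<open>Since a tiebreak won after an odd number of points still counts as won one point later,
  its winner is determined by the scores after even numbers of points.\<close>

lemma wins_tiebreak_iff_even:
  "wins_tiebreak v p \<longleftrightarrow>
     (\<exists>k. tiebreak_won_at v p (2 * k) \<and> (\<forall>j<k. \<not> tiebreak_won_at v (opponent p) (2 * j)))"
    (is "_ \<longleftrightarrow> ?R")
proof
  assume "wins_tiebreak v p"
  then obtain n where n: "tiebreak_won_at v p n" "\<And>m. m < n \<Longrightarrow> \<not> tiebreak_won_at v (opponent p) m"
    unfolding wins_tiebreak_def by blast
  show ?R
  proof (cases "even n")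
    case True
    then obtain k where "n = 2 * k" by (elim evenE)
    with n show ?R by auto
  next
    case False
    then obtain k where k: "n = 2 * k + 1" by (elim oddE)
    have "tiebreak_won_at v p (2 * Suc k)"
      using tiebreak_won_at_Suc_if_odd[OF n(1) False] k by simp
    with n k show ?R by (intro exI[of _ "Suc k"]) auto
  qed
next
  assume ?R
  then obtain k where k: "tiebreak_won_at v p (2 * k)"
    "\<And>j. j < k \<Longrightarrow> \<not> tiebreak_won_at v (opponent p) (2 * j)" by blast
  have "\<not> tiebreak_won_at v (opponent p) m" if "m < 2 * k" for m
  proof
    assume m: "tiebreak_won_at v (opponent p) m"
    show False
    proof (cases "even m")
      case True
      with k(2) m that show False by (auto elim!: evenE)
    next
      case False
      then obtain j where j: "m = 2 * j + 1" by (elim oddE)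
      have "tiebreak_won_at v (opponent p) (2 * Suc j)"
        using tiebreak_won_at_Suc_if_odd[OF m False] j by simp
      moreover have "Suc j \<le> k" using j that by simp
      ultimately have "tiebreak_won_at v (opponent p) (2 * k)"
        using k(2)[of "Suc j"] by (cases "Suc j = k") auto
      with k(1) show False by (simp add: tiebreak_won_at_def)
    qed
  qed
  with k(1) show "wins_tiebreak v p" unfolding wins_tiebreak_def by blast
qed

lemma wins_tiebreak_swap: "wins_tiebreak (\<lambda>j. v (partner j)) p \<longleftrightarrow> wins_tiebreak v p"
  unfolding wins_tiebreak_iff_even tiebreak_won_at_def by (simp add: score_swap[of _ _ v])

section \<open>The game difference as a sum over the games played\<close>

definition over_at :: "(nat \<Rightarrow> player) \<Rightarrow> nat \<Rightarrow> bool" where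
  "over_at w n \<longleftrightarrow> set_over (score w PlayerA n) (score w PlayerB n)"

definition played :: "(nat \<Rightarrow> player) \<Rightarrow> nat \<Rightarrow> bool" where
  "played w n \<longleftrightarrow> (\<forall>m\<le>n. \<not> over_at w m)"

definition gain :: "player \<Rightarrow> real" where
  "gain x = (if x = PlayerA then 1 else -1)"

definition net_games :: "(nat \<Rightarrow> player) \<Rightarrow> real" where
  "net_games w = (\<Sum>i<13. if played w i then gain (w i) else 0)"

text \<open>
  Some player wins the set with 6 games by winning the next game. Set points at 6-5 are not
  included: what matters below are the set points after an even number of games.
\<close>

definition set_point :: "(nat \<Rightarrow> player) \<Rightarrow> nat \<Rightarrow> bool" where
  "set_point w n \<longleftrightarrow> (\<exists>p. score w p n = 5 \<and> score w (opponent p) n \<le> 4)"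

lemma not_set_over_12:
  "\<not> set_over a b \<Longrightarrow> a + b = 12 \<Longrightarrow> a = 6 \<and> b = 6"
  unfolding set_over_def by linarith

text \<open>In general a further game can undo the end of a set: 6-4 is a final score, 6-5 is not. After
  an odd number of games the lead is odd, hence at least 3, and one game more leaves it at least 2.\<close>

lemma set_over_Suc_if_odd:
  assumes "set_over a b" "odd (a + b)" "a + b < 12"
  shows "set_over (Suc a) b" "set_over a (Suc b)"
proof -
  have "a \<noteq> b + 2" "b \<noteq> a + 2" using assms(2) by auto
  then show "set_over (Suc a) b" "set_over a (Suc b)"
    using assms(1,3) unfolding set_over_def by auto
qed

text \<open>The scores from which a set can end after an odd number of games, the tiebreak apart. A set
  that reaches ten games ends there with 6-4 or is tied 5-5, and cannot end in the eleventh game.\<close>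

lemma set_over_Suc_if_even:
  assumes "\<not> set_over a b" "even (a + b)" "a + b < 12"
  shows "set_over (Suc a) b \<longleftrightarrow> a = 5 \<and> b \<le> 4"
    and "set_over a (Suc b) \<longleftrightarrow> b = 5 \<and> a \<le> 4"
proof -
  have "a \<noteq> b + 1" "b \<noteq> a + 1" using assms(2) by auto
  then show "set_over (Suc a) b \<longleftrightarrow> a = 5 \<and> b \<le> 4"
    "set_over a (Suc b) \<longleftrightarrow> b = 5 \<and> a \<le> 4"
    using assms(1,3) unfolding set_over_def by auto
qed

lemma over_by_13: "\<exists>n\<le>13. over_at w n"
proof (cases "over_at w 12")
  case False
  have s: "score w PlayerA 12 + score w PlayerB 12 = 12" by (rule score_total_AB)
  have "score w PlayerA 12 = 6 \<and> score w PlayerB 12 = 6"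
    using False s unfolding over_at_def by (rule not_set_over_12)
  then have "over_at w (Suc 12)"
    unfolding over_at_def set_over_def by (cases "w 12") (simp_all add: score_Suc del: Suc_numeral)
  then show ?thesis by (intro exI[of _ "Suc 12"]) simp
qed (auto intro: exI[of _ 12])

lemma lead_eq_sum_gain:
  "real (score w PlayerA n) - real (score w PlayerB n) = (\<Sum>i<n. gain (w i))"
proof (induction n)
  case (Suc n)
  then show ?case by (cases "w n") (auto simp: score_Suc gain_def)
qed simp

text \<open>A sum of fixed length is easier to handle than a score at a random time, both for the
  comparison of two sets and for measurability.\<close>

lemma game_difference_eq_net_games: "game_difference \<omega> = net_games (game_winner \<omega>)"
proof -
  let ?w = "game_winner \<omega>"
  define N where "N = (LEAST n. over_at ?w n)"
  obtain n where n: "n \<le> 13" "over_at ?w n" using over_by_13 by blast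
  have N: "over_at ?w N" unfolding N_def using n(2) by (rule LeastI)
  have "N \<le> 13" using n Least_le[of "over_at ?w" n] by (simp add: N_def)
  have played: "played ?w i \<longleftrightarrow> i < N" for i
    using N not_less_Least[of _ "over_at ?w"] unfolding played_def N_def
    by (meson leI le_less_trans)
  have "game_difference \<omega> = (\<Sum>i<N. gain (?w i))"
    unfolding game_difference_def set_length_def over_at_def[symmetric] N_def[symmetric]
    by (rule lead_eq_sum_gain)
  also have "\<dots> = (\<Sum>i<13. if i < N then gain (?w i) else 0)"
    using \<open>N \<le> 13\<close> by (intro sum.mono_neutral_cong_left) auto
  finally show ?thesis by (simp add: net_games_def played)
qed

lemma over_at_Suc_if_odd:
  assumes "over_at w n" "odd n" "n < 12"
  shows "over_at w (Suc n)"
  using assms score_total_AB[of w n]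
    set_over_Suc_if_odd[of "score w PlayerA n" "score w PlayerB n"]
  by (cases "w n") (simp_all add: over_at_def score_Suc)

text \<open>A set over after an odd number of games would also be over one game later, so whether the
  first game of a pair is played can be read off from the scores at even times.\<close>

lemma played_even_iff:
  assumes "k \<le> 6"
  shows "played w (2 * k) \<longleftrightarrow> (\<forall>j\<le>k. \<not> over_at w (2 * j))"
proof
  assume R: "\<forall>j\<le>k. \<not> over_at w (2 * j)"
  have "\<not> over_at w m" if "m \<le> 2 * k" for m
  proof
    assume m: "over_at w m"
    show False
    proof (cases "even m")
      case True
      with R m that show False by (auto elim!: evenE)
    next
      case False
      then obtain j where j: "m = 2 * j + 1" by (elim oddE)
      have le: "Suc j \<le> k" using j that by simp
      then have "over_at w (2 * Suc j)"
        using over_at_Suc_if_odd[OF m False] assms j by simp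
      with le show False using R by blast
    qed
  qed
  then show "played w (2 * k)" by (simp add: played_def)
qed (simp add: played_def)

lemma played_Suc: "played w (Suc n) \<longleftrightarrow> played w n \<and> \<not> over_at w (Suc n)"
  by (auto simp: played_def le_Suc_eq)

lemma played_if_set_point:
  assumes "set_point w n"
  shows "played w n"
proof -
  obtain p where "score w p n = 5 \<and> score w (opponent p) n \<le> 4"
    using assms unfolding set_point_def by blast
  then have "score w PlayerA n \<le> 5" "score w PlayerB n \<le> 5" by (cases p; simp)+
  then have "score w PlayerA m \<le> 5" "score w PlayerB m \<le> 5" if "m \<le> n" for m
    using score_mono[OF that, of w PlayerA] score_mono[OF that, of w PlayerB] by linarith+
  then show ?thesis by (fastforce simp: played_def over_at_def set_over_def)
qed

lemma over_after_even_iff: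
  assumes "k < 6" "\<not> over_at w (2 * k)"
  shows "over_at w (Suc (2 * k)) \<longleftrightarrow>
    score w (w (2 * k)) (2 * k) = 5 \<and> score w (opponent (w (2 * k))) (2 * k) \<le> 4"
  using assms score_total_AB[of w "2 * k"]
    set_over_Suc_if_even[of "score w PlayerA (2 * k)" "score w PlayerB (2 * k)"]
  by (cases "w (2 * k)") (simp_all add: over_at_def score_Suc)

section \<open>The effect of the exchange on the game difference\<close>

lemma sum_consecutive_pairs:
  fixes f :: "nat \<Rightarrow> 'a::comm_monoid_add"
  shows "(\<Sum>i<2 * m. f i) = (\<Sum>k<m. f (2 * k) + f (Suc (2 * k)))"
  by (induction m) (simp_all add: add.assoc)

lemma net_games_pairs:
  "net_games w = (\<Sum>k<6. if played w (2 * k)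
     then gain (w (2 * k)) + (if over_at w (Suc (2 * k)) then 0 else gain (w (Suc (2 * k)))) else 0)
   + (if played w 12 then gain (w 12) else 0)"
proof -
  let ?f = "\<lambda>i. if played w i then gain (w i) else 0"
  have "net_games w = (\<Sum>i<2 * 6. ?f i) + ?f 12"
    using sum.lessThan_Suc[of ?f 12] by (simp add: net_games_def)
  also have "(\<Sum>i<2 * 6. ?f i) = (\<Sum>k<6. ?f (2 * k) + ?f (Suc (2 * k)))"
    by (rule sum_consecutive_pairs)
  also have "\<dots> = (\<Sum>k<6. if played w (2 * k)
     then gain (w (2 * k)) + (if over_at w (Suc (2 * k)) then 0 else gain (w (Suc (2 * k)))) else 0)"
    by (intro sum.cong refl) (auto simp: played_Suc)
  finally show ?thesis .
qed

text \<open>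
  Both sets play the first game of the same pairs, and the tiebreak in the same cases. In a pair
  whose first game is played, the two contributions can differ only if one of the sets ends after
  that first game, that is, at a set point. There, if the leader wins both games, both sets skip
  the second one; if he loses both, neither does; if the two games are split, the set where the
  leader loses first plays one game more, which the leader wins.
\<close>

lemma net_games_swap_diff:
  assumes swap: "\<And>i. i < 12 \<Longrightarrow> w' i = w (partner i)" and last: "w' 12 = w 12"
  shows "net_games w - net_games w' = (\<Sum>k<6. of_bool (set_point w (2 * k)) *
    (of_bool (w (2 * k) = PlayerA) - of_bool (w (Suc (2 * k)) = PlayerA)))"
proof -
  have score: "score w' p (2 * k) = score w p (2 * k)" if "k \<le> 6" for p k
    using that by (intro score_swap swap) simp
  have over: "over_at w' (2 * k) \<longleftrightarrow> over_at w (2 * k)" if "k \<le> 6" for k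
    using score[OF that] by (simp add: over_at_def)
  have played: "played w' (2 * k) \<longleftrightarrow> played w (2 * k)" if "k \<le> 6" for k
    using over that by (simp add: played_even_iff)
  have pair: "(if played w (2 * k)
        then gain (w (2 * k)) + (if over_at w (Suc (2 * k)) then 0 else gain (w (Suc (2 * k)))) else 0)
    - (if played w' (2 * k)
        then gain (w' (2 * k)) + (if over_at w' (Suc (2 * k)) then 0 else gain (w' (Suc (2 * k)))) else 0)
    = of_bool (set_point w (2 * k)) *
      (of_bool (w (2 * k) = PlayerA) - of_bool (w (Suc (2 * k)) = PlayerA))" if k: "k < 6" for k
  proof (cases "played w (2 * k)")
    case False
    then show ?thesis using played[of k] played_if_set_point[of w "2 * k"] k by auto
  next
    case True
    have w': "w' (2 * k) = w (Suc (2 * k))" "w' (Suc (2 * k)) = w (2 * k)"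
      using swap k by simp_all
    have "\<not> over_at w (2 * k)" using True by (simp add: played_def)
    then have ov: "over_at w (Suc (2 * k)) \<longleftrightarrow>
        score w (w (2 * k)) (2 * k) = 5 \<and> score w (opponent (w (2 * k))) (2 * k) \<le> 4"
      "over_at w' (Suc (2 * k)) \<longleftrightarrow>
        score w (w (Suc (2 * k))) (2 * k) = 5 \<and> score w (opponent (w (Suc (2 * k)))) (2 * k) \<le> 4"
      using k over_after_even_iff[of k w] over_after_even_iff[of k w'] over[of k] score[of k] w'
      by simp_all
    have sp: "set_point w (2 * k) \<longleftrightarrow> score w PlayerA (2 * k) = 5 \<and> score w PlayerB (2 * k) \<le> 4
      \<or> score w PlayerB (2 * k) = 5 \<and> score w PlayerA (2 * k) \<le> 4"
      unfolding set_point_def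
    proof (intro iffI; elim exE disjE)
      fix p assume "score w p (2 * k) = 5 \<and> score w (opponent p) (2 * k) \<le> 4"
      then show "score w PlayerA (2 * k) = 5 \<and> score w PlayerB (2 * k) \<le> 4
        \<or> score w PlayerB (2 * k) = 5 \<and> score w PlayerA (2 * k) \<le> 4" by (cases p) auto
    qed (auto intro: exI[of _ PlayerA] exI[of _ PlayerB])
    show ?thesis
      using True played[of k] k unfolding ov sp w'
      by (cases "w (2 * k)"; cases "w (Suc (2 * k))") (auto simp: gain_def)
  qed
  have "played w' 12 = played w 12" using played[of 6] by simp
  then show ?thesis
    unfolding net_games_pairs last by (simp add: sum_subtractf[symmetric] pair del: sum_subtractf)
qed

text \<open>The restriction is there because the points of a finite product space are undefined outside
  the index set.\<close>

definition swap_outcome :: "outcome \<Rightarrow> outcome" where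
  "swap_outcome \<omega> = (\<lambda>i\<in>{..<12}. fst \<omega> (partner i), \<lambda>j. snd \<omega> (partner j))"

lemma game_difference_swap:
  "game_difference \<omega> - game_difference (swap_outcome \<omega>) =
   (\<Sum>k<6. of_bool (set_point (fst \<omega>) (2 * k)) *
    (of_bool (fst \<omega> (2 * k) = PlayerA) - of_bool (fst \<omega> (Suc (2 * k)) = PlayerA)))"
proof -
  let ?w = "game_winner \<omega>" and ?w' = "game_winner (swap_outcome \<omega>)"
  have "?w' i = ?w (partner i)" if "i < 12" for i
    using that partner_less_even[of i 6] by (simp add: game_winner_def swap_outcome_def)
  moreover have "?w' 12 = ?w 12"
    by (simp add: game_winner_def swap_outcome_def wins_tiebreak_swap)
  moreover have "set_point ?w (2 * k) = set_point (fst \<omega>) (2 * k)" if "k < 6" for k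
    using that score_cong[of "2 * k" ?w "fst \<omega>"] by (simp add: set_point_def game_winner_def)
  moreover have "?w (2 * k) = fst \<omega> (2 * k)" "?w (Suc (2 * k)) = fst \<omega> (Suc (2 * k))"
    if "k < 6" for k
    using that by (simp_all add: game_winner_def)
  ultimately show ?thesis
    unfolding game_difference_eq_net_games
    by (subst net_games_swap_diff[of ?w' ?w]) (auto intro!: sum.cong)
qed

section \<open>The probability of winning a game on own serve\<close>

text \<open>The denominator is the probability that one of the players wins both of the next two
  points, which ends a game from deuce.\<close>

lemma deuce_denominator_pos: "(0::real) < 1 - 2 * x * (1 - x)"
proof -
  have "1 - 2 * x * (1 - x) = x ^ 2 + (1 - x) ^ 2" by (simp add: power2_eq_square algebra_simps)
  also have "\<dots> > 0" by (cases "x = 0") (auto intro: add_pos_nonneg)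
  finally show ?thesis .
qed

lemma game_prob_mult_denominator:
  "game_prob x * (1 - 2 * x * (1 - x)) = x ^ 4 * ((15 - 4 * x) * (1 - 2 * x * (1 - x)) - 10 * x ^ 2)"
proof -
  have "(15 - 4 * x - 10 * x ^ 2 / d) * d = (15 - 4 * x) * d - 10 * x ^ 2" if "d \<noteq> 0" for d
    using that by (simp add: left_diff_distrib)
  with deuce_denominator_pos[of x] show ?thesis
    unfolding game_prob_def mult.assoc[of "x ^ 4"] by (metis less_irrefl)
qed

text \<open>Server and receiver play by the same rules, so the receiver's probability of winning the game
  is that of a server who wins points with probability \<open>1 - x\<close>. This reduces the upper
  bound on the probability to the lower one.\<close>

lemma game_prob_compl: "game_prob (1 - x) = 1 - game_prob x"
proof -
  let ?d = "1 - 2 * x * (1 - x)"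
  have "game_prob (1 - x) * ?d = (1 - x) ^ 4 * ((15 - 4 * (1 - x)) * ?d - 10 * (1 - x) ^ 2)"
    using game_prob_mult_denominator[of "1 - x"] by (simp add: mult.commute mult.left_commute)
  also have "\<dots> = ?d - x ^ 4 * ((15 - 4 * x) * ?d - 10 * x ^ 2)" by algebra
  also have "\<dots> = (1 - game_prob x) * ?d"
    unfolding left_diff_distrib[of 1 "game_prob x"] game_prob_mult_denominator by simp
  finally show ?thesis using deuce_denominator_pos[of x] by simp
qed

text \<open>The polynomial in the proof lists the ways to win the game, up to the factor \<open>?d\<close>: to 0, 15 and 30 in
  the summands with 1, 4 and 10, and from deuce, reached with three points each, in the last one.\<close>

lemma game_prob_pos:
  assumes "0 < x" "x < 1"
  shows "0 < game_prob x"
proof -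
  let ?d = "1 - 2 * x * (1 - x)" and ?y = "1 - x"
  have "game_prob x * ?d = x ^ 4 * ((1 + 4 * ?y + 10 * ?y ^ 2) * ?d + 20 * x * ?y ^ 3)"
    unfolding game_prob_mult_denominator by algebra
  also have "\<dots> > 0" using assms deuce_denominator_pos[of x]
    by (intro mult_pos_pos add_pos_nonneg mult_nonneg_nonneg) auto
  finally show ?thesis using deuce_denominator_pos[of x] by (simp add: zero_less_mult_iff)
qed

lemma game_prob_bounds:
  assumes "0 < x" "x < 1"
  shows "0 < game_prob x" "game_prob x < 1"
  using game_prob_pos[of x] game_prob_pos[of "1 - x"] assms by (simp_all add: game_prob_compl)

section \<open>The law of a set\<close>

lemma pmf_winner:
  assumes "0 \<le> p" "p \<le> 1"
  shows "pmf (winner_pmf s p) s = p" "pmf (winner_pmf s p) (opponent s) = 1 - p"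
proof -
  have inj: "inj (\<lambda>b. if b then s else opponent s)" by (rule injI) (simp split: if_splits)
  show "pmf (winner_pmf s p) s = p" "pmf (winner_pmf s p) (opponent s) = 1 - p"
    using pmf_map_inj'[OF inj, of "bernoulli_pmf p" True] pmf_map_inj'[OF inj, of "bernoulli_pmf p" False]
      assms by (simp_all add: winner_pmf_def)
qed

lemma finite_player: "finite (UNIV :: player set)"
proof (rule finite_subset)
  show "UNIV \<subseteq> {PlayerA, PlayerB}" using player.exhaust by blast
qed simp

text \<open>
  The sets of the model depend neither on the probabilities nor on the first server. As there
  are only finitely many sequences of winners of twelve games, every set of them is measurable.
\<close>

abbreviation games_space :: "(nat \<Rightarrow> player) measure" where
  "games_space \<equiv> count_space (PiE {..<12} (\<lambda>_. UNIV))"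

abbreviation tiebreak_space :: "(nat \<Rightarrow> player) measure" where
  "tiebreak_space \<equiv> PiM UNIV (\<lambda>_. count_space UNIV)"

definition games_model :: "(player \<Rightarrow> real) \<Rightarrow> player \<Rightarrow> (nat \<Rightarrow> player) measure" where
  "games_model P s =
     (\<Pi>\<^sub>M i\<in>{..<12}. measure_pmf (winner_pmf (game_server s i) (game_prob (P (game_server s i)))))"

definition tiebreak_model :: "(player \<Rightarrow> real) \<Rightarrow> player \<Rightarrow> (nat \<Rightarrow> player) measure" where
  "tiebreak_model P s =
     (\<Pi>\<^sub>M j\<in>UNIV. measure_pmf (winner_pmf (tiebreak_server s j) (P (tiebreak_server s j))))"

lemma set_model_eq: "set_model P s = games_model P s \<Otimes>\<^sub>M tiebreak_model P s"
  by (simp add: set_model_def games_model_def tiebreak_model_def)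

lemma prob_space_games_model: "prob_space (games_model P s)"
  unfolding games_model_def by (intro prob_space_PiM measure_pmf.prob_space_axioms)

lemma prob_space_tiebreak_model: "prob_space (tiebreak_model P s)"
  unfolding tiebreak_model_def by (intro prob_space_PiM measure_pmf.prob_space_axioms)

lemma prob_space_set_model: "prob_space (set_model P s)"
  unfolding set_model_eq by (intro prob_space_pair prob_space_games_model prob_space_tiebreak_model)

lemma sets_PiM_pmf:
  fixes q :: "'i \<Rightarrow> 'a pmf"
  assumes "finite I" "finite (UNIV :: 'a set)"
  shows "sets (\<Pi>\<^sub>M i\<in>I. measure_pmf (q i)) = sets (count_space (PiE I (\<lambda>_. UNIV)))"
proof -
  have "sets (\<Pi>\<^sub>M i\<in>I. measure_pmf (q i)) = sets (\<Pi>\<^sub>M i\<in>I. count_space UNIV)"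
    by (intro sets_PiM_cong) simp_all
  then show ?thesis using assms by (simp add: count_space_PiM_finite countable_finite)
qed

lemma sets_games_model [measurable_cong]: "sets (games_model P s) = sets games_space"
  unfolding games_model_def by (rule sets_PiM_pmf[OF _ finite_player]) simp

lemma sets_tiebreak_model [measurable_cong]: "sets (tiebreak_model P s) = sets tiebreak_space"
  unfolding tiebreak_model_def by (intro sets_PiM_cong) simp_all

lemma measurable_wins_tiebreak [measurable]: "Measurable.pred tiebreak_space (\<lambda>v. wins_tiebreak v p)"
  unfolding wins_tiebreak_def tiebreak_won_at_def score_eq_sum by measurable

text \<open>The winners of the games take finitely many values, and for each of them the tiebreak enters
  only through its winner.\<close>

lemma measurable_game_difference: "game_difference \<in> borel_measurable (games_space \<Otimes>\<^sub>M tiebreak_space)"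
proof -
  have "game_difference (g, v) = (if wins_tiebreak v PlayerA
      then net_games (\<lambda>i. if i < 12 then g i else PlayerA)
      else net_games (\<lambda>i. if i < 12 then g i else PlayerB))" for g v
  proof -
    have "game_winner (g, v) = (\<lambda>i. if i < 12 then g i else if wins_tiebreak v PlayerA then PlayerA else PlayerB)"
      by (simp add: fun_eq_iff game_winner_def)
    then show ?thesis by (simp add: game_difference_eq_net_games)
  qed
  then have "(\<lambda>\<omega>. game_difference (g, snd \<omega>)) \<in> borel_measurable (games_space \<Otimes>\<^sub>M tiebreak_space)" for g
    by simp
  moreover have "countable (PiE {..<12::nat} (\<lambda>_. UNIV :: player set))"
    by (intro countable_finite finite_PiE) (simp_all add: finite_player)
  ultimately have "(\<lambda>\<omega>. game_difference (fst \<omega>, snd \<omega>)) \<in> borel_measurable (games_space \<Otimes>\<^sub>M tiebreak_space)"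
    by (intro measurable_compose_countable'[where f="\<lambda>g \<omega>. game_difference (g, snd \<omega>)" and g=fst]) simp_all
  then show ?thesis by simp
qed

lemma game_server_partner: "game_server s (partner i) = game_server (opponent s) i"
  by (auto simp: game_server_def partner_def)

lemma tiebreak_server_partner: "tiebreak_server s (partner j) = tiebreak_server (opponent s) j"
proof (cases "even j")
  case True
  then obtain k where "j = 2 * k" by (elim evenE)
  then show ?thesis by (simp add: tiebreak_server_def)
next
  case False
  then obtain k where "j = 2 * k + 1" by (elim oddE)
  then show ?thesis by (simp add: tiebreak_server_def)
qed

text \<open>The exchange reindexes the product measures by the involution \<open>partner\<close>, which
  exchanges the servers: \<open>game_server_partner\<close> and \<open>tiebreak_server_partner\<close>.\<close>

lemma set_model_opponent:
  "set_model P (opponent s) = distr (set_model P s) (set_model P (opponent s)) swap_outcome"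
proof -
  let ?g = "\<lambda>f::nat \<Rightarrow> player. \<lambda>i\<in>{..<12}. f (partner i)"
  let ?t = "\<lambda>f::nat \<Rightarrow> player. \<lambda>j. f (partner j)"
  have swap: "swap_outcome = (\<lambda>(x, y). (?g x, ?t y))"
    by (simp add: fun_eq_iff swap_outcome_def split_beta)
  have g: "distr (games_model P s) (games_model P (opponent s)) ?g = games_model P (opponent s)"
    using distr_PiM_reindex[of "{..<12}" "\<lambda>i. measure_pmf (winner_pmf (game_server s i)
        (game_prob (P (game_server s i))))" partner "{..<12}"]
      partner_less_even[of _ 6] inj_partner
    by (auto simp: games_model_def game_server_partner measure_pmf.prob_space_axioms intro: inj_on_subset)
  have t: "distr (tiebreak_model P s) (tiebreak_model P (opponent s)) ?t = tiebreak_model P (opponent s)"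
    using distr_PiM_reindex[of UNIV "\<lambda>j. measure_pmf (winner_pmf (tiebreak_server s j)
        (P (tiebreak_server s j)))" partner UNIV] inj_partner
    by (simp add: tiebreak_model_def tiebreak_server_partner measure_pmf.prob_space_axioms restrict_UNIV)
  have "?g \<in> games_space \<rightarrow>\<^sub>M games_space" by auto
  then have gm: "?g \<in> games_model P s \<rightarrow>\<^sub>M games_model P (opponent s)"
    using measurable_cong_sets[OF sets_games_model sets_games_model] by blast
  have "?t \<in> tiebreak_space \<rightarrow>\<^sub>M tiebreak_space"
    by (rule measurable_PiM_single') (auto simp: space_PiM)
  then have tm: "?t \<in> tiebreak_model P s \<rightarrow>\<^sub>M tiebreak_model P (opponent s)"
    using measurable_cong_sets[OF sets_tiebreak_model sets_tiebreak_model] by blast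
  have "sigma_finite_measure (distr (tiebreak_model P s) (tiebreak_model P (opponent s)) ?t)"
    unfolding t
    using prob_space_tiebreak_model by (intro finite_measure.sigma_finite_measure) (simp add: prob_space_def)
  from pair_measure_distr[OF gm tm this] show ?thesis
    unfolding g t set_model_eq swap .
qed

lemma sets_set_model: "sets (set_model P s) = sets (games_space \<Otimes>\<^sub>M tiebreak_space)"
  unfolding set_model_eq by (intro sets_pair_measure_cong sets_games_model sets_tiebreak_model)

lemma measurable_game_difference_set_model: "game_difference \<in> borel_measurable (set_model P s)"
  using measurable_game_difference measurable_cong_sets[OF sets_set_model refl] by blast

lemma measurable_swap_outcome: "swap_outcome \<in> set_model P s \<rightarrow>\<^sub>M set_model P s'"
proof -
  have "swap_outcome \<in> games_space \<Otimes>\<^sub>M tiebreak_space \<rightarrow>\<^sub>M games_space \<Otimes>\<^sub>M tiebreak_space"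
    unfolding swap_outcome_def
  proof (rule measurable_Pair)
    show "(\<lambda>\<omega>. \<lambda>i\<in>{..<12}. fst \<omega> (partner i)) \<in> games_space \<Otimes>\<^sub>M tiebreak_space \<rightarrow>\<^sub>M games_space"
      by (rule measurable_compose[OF measurable_fst]) auto
    show "(\<lambda>\<omega> j. snd \<omega> (partner j)) \<in> games_space \<Otimes>\<^sub>M tiebreak_space \<rightarrow>\<^sub>M tiebreak_space"
      by (rule measurable_compose[OF measurable_snd], rule measurable_PiM_single') (auto simp: space_PiM)
  qed
  then show ?thesis using measurable_cong_sets[OF sets_set_model sets_set_model] by blast
qed

lemma abs_net_games_le: "\<bar>net_games w\<bar> \<le> 13"
proof -
  have "\<bar>net_games w\<bar> \<le> (\<Sum>i<13. \<bar>if played w i then gain (w i) else 0\<bar>)"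
    unfolding net_games_def by (rule sum_abs)
  also have "\<dots> \<le> (\<Sum>i<13::nat. 1)" by (intro sum_mono) (simp add: gain_def)
  finally show ?thesis by simp
qed

text \<open>Both expectations become integrals over the same probability space, where the pathwise
  comparison applies. The tiebreak does not occur in it and is integrated out.\<close>

lemma H_set_diff:
  "H_set P s - H_set P (opponent s) =
   (\<integral>g. (\<Sum>k<6. of_bool (set_point g (2 * k)) *
      (of_bool (g (2 * k) = PlayerA) - of_bool (g (Suc (2 * k)) = PlayerA))) \<partial>games_model P s)"
    (is "_ = integral\<^sup>L _ ?D")
proof -
  interpret prob_space "set_model P s" by (rule prob_space_set_model)
  have bound: "\<bar>game_difference \<omega>\<bar> \<le> 13" for \<omega>
    by (simp add: game_difference_eq_net_games abs_net_games_le)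
  have D: "integrable (set_model P s) game_difference"
    by (rule integrable_const_bound[of _ 13]) (simp_all add: bound measurable_game_difference_set_model)
  have D': "integrable (set_model P s) (\<lambda>\<omega>. game_difference (swap_outcome \<omega>))"
    by (rule integrable_const_bound[of _ 13])
      (simp_all add: bound measurable_compose[OF measurable_swap_outcome measurable_game_difference_set_model])
  have "H_set P (opponent s) = (\<integral>\<omega>. game_difference (swap_outcome \<omega>) \<partial>set_model P s)"
    unfolding H_set_def
    by (subst set_model_opponent) (rule integral_distr[OF measurable_swap_outcome measurable_game_difference_set_model])
  then have "H_set P s - H_set P (opponent s) =
      (\<integral>\<omega>. game_difference \<omega> - game_difference (swap_outcome \<omega>) \<partial>set_model P s)"
    unfolding H_set_def using D D' by simp
  also have "\<dots> = (\<integral>\<omega>. ?D (fst \<omega>) \<partial>(games_model P s \<Otimes>\<^sub>M tiebreak_model P s))"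
    unfolding game_difference_swap set_model_eq ..
  also have "\<dots> = integral\<^sup>L (distr (games_model P s \<Otimes>\<^sub>M tiebreak_model P s) (games_model P s) fst) ?D"
    by (rule integral_distr[symmetric])
      (simp_all add: measurable_cong_sets[OF sets_games_model refl])
  also have "\<dots> = integral\<^sup>L (games_model P s) ?D"
    by (simp only: prob_space.distr_pair_fst[OF prob_space_tiebreak_model])
  finally show ?thesis .
qed

section \<open>Expected gain at set points\<close>

lemma indep_vars_PiM_components:
  assumes "I \<noteq> {}" "\<And>i. i \<in> I \<Longrightarrow> prob_space (M i)"
  shows "prob_space.indep_vars (PiM I M) M (\<lambda>i f. f i) I"
proof -
  interpret prob_space "PiM I M" by (rule prob_space_PiM) (rule assms)
  have "distr (PiM I M) (PiM I M) (\<lambda>f. \<lambda>i\<in>I. f i) = distr (PiM I M) (PiM I M) (\<lambda>f. f)"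
    by (intro distr_cong) (auto simp: space_PiM)
  also have "\<dots> = PiM I (\<lambda>i. distr (PiM I M) (M i) (\<lambda>f. f i))"
    using assms by (auto simp: distr_id distr_PiM_component intro!: PiM_cong)
  finally show ?thesis
    using assms(1) by (subst indep_vars_iff_distr_eq_PiM') auto
qed

lemma set_point_cong:
  "(\<And>i. i < n \<Longrightarrow> w i = w' i) \<Longrightarrow> set_point w n \<longleftrightarrow> set_point w' n"
  unfolding set_point_def using score_cong[of n w w'] by simp

text \<open>Whether a set point occurs at the start of a pair depends on earlier games only, which
  are independent of the two games of the pair.\<close>

lemma expectation_set_point:
  fixes q :: "nat \<Rightarrow> player pmf"
  assumes k: "Suc (2 * k) < N"
  defines "M \<equiv> \<Pi>\<^sub>M i\<in>{..<N}. measure_pmf (q i)"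
  shows "(\<integral>g. of_bool (set_point g (2 * k)) *
      (of_bool (g (2 * k) = PlayerA) - of_bool (g (Suc (2 * k)) = PlayerA)) \<partial>M) =
    measure M {g \<in> space M. set_point g (2 * k)} *
      (pmf (q (2 * k)) PlayerA - pmf (q (Suc (2 * k))) PlayerA)"
proof -
  let ?M = "\<lambda>i. measure_pmf (q i)"
  let ?I = "{..<2 * k}" and ?J = "{2 * k, Suc (2 * k)}"
  let ?Y = "\<lambda>g. of_bool (set_point g (2 * k)) :: real"
  let ?Z = "\<lambda>g. of_bool (g (2 * k) = PlayerA) - of_bool (g (Suc (2 * k)) = PlayerA) :: real"
  interpret prob_space M unfolding M_def by (intro prob_space_PiM measure_pmf.prob_space_axioms)
  have any: "f \<in> borel_measurable (PiM K ?M)" if "finite K" for f :: "_ \<Rightarrow> real" and K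
    by (subst measurable_cong_sets[OF sets_PiM_pmf[OF that finite_player] refl]) simp
  have int: "integrable M f" if "\<And>g. \<bar>f g\<bar> \<le> 1" for f :: "_ \<Rightarrow> real"
    by (rule integrable_const_bound[of _ 1]) (use that any[of "{..<N}" f] in \<open>auto simp: M_def\<close>)
  have "indep_vars ?M (\<lambda>i g. g i) {..<N}"
    unfolding M_def using k
    by (intro indep_vars_PiM_components) (auto simp: measure_pmf.prob_space_axioms)
  then have "indep_var (PiM ?I ?M) (\<lambda>g. \<lambda>i\<in>?I. g i) (PiM ?J ?M) (\<lambda>g. \<lambda>i\<in>?J. g i)"
    using k by (intro indep_var_restrict) auto
  then have "indep_var borel (?Y \<circ> (\<lambda>g. \<lambda>i\<in>?I. g i)) borel (?Z \<circ> (\<lambda>g. \<lambda>i\<in>?J. g i))"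
    by (rule indep_var_compose) (auto intro!: any)
  moreover have "?Y \<circ> (\<lambda>g. \<lambda>i\<in>?I. g i) = ?Y"
  proof -
    have "set_point (\<lambda>i\<in>?I. g i) (2 * k) = set_point g (2 * k)" for g
      by (rule set_point_cong) simp
    then show ?thesis by (simp add: fun_eq_iff)
  qed
  moreover have "?Z \<circ> (\<lambda>g. \<lambda>i\<in>?J. g i) = ?Z" by (simp add: fun_eq_iff)
  ultimately have "indep_var borel ?Y borel ?Z" by simp
  then have "(\<integral>g. ?Y g * ?Z g \<partial>M) = (\<integral>g. ?Y g \<partial>M) * (\<integral>g. ?Z g \<partial>M)"
    by (rule indep_var_lebesgue_integral) (auto intro!: int)
  also have "(\<integral>g. ?Y g \<partial>M) = measure M {g \<in> space M. set_point g (2 * k)}"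
  proof -
    have "(\<integral>g. ?Y g \<partial>M) = (\<integral>g. indicator {g. set_point g (2 * k)} g \<partial>M)"
      by (intro Bochner_Integration.integral_cong) (auto simp: indicator_def)
    then show ?thesis by (simp add: Int_def conj_commute)
  qed
  also have "(\<integral>g. ?Z g \<partial>M) = pmf (q (2 * k)) PlayerA - pmf (q (Suc (2 * k))) PlayerA"
  proof -
    have "(\<integral>g. of_bool (g i = PlayerA) \<partial>M) = pmf (q i) PlayerA" if "i < N" for i
    proof -
      have "(\<integral>g. of_bool (g i = PlayerA) \<partial>M) =
          (\<integral>x. (of_bool (x = PlayerA) :: real) \<partial>distr M (?M i) (\<lambda>g. g i))"
        using that by (intro integral_distr[symmetric]) (auto simp: M_def)
      also have "distr M (?M i) (\<lambda>g. g i) = ?M i"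
        unfolding M_def using that by (intro distr_PiM_component) (auto simp: measure_pmf.prob_space_axioms)
      also have "(\<integral>x. (of_bool (x = PlayerA) :: real) \<partial>?M i) = (\<integral>x. indicator {PlayerA} x \<partial>?M i)"
        by (intro Bochner_Integration.integral_cong) (auto simp: indicator_def)
      finally show ?thesis by (simp add: measure_pmf_single)
    qed
    then show ?thesis using k by (subst Bochner_Integration.integral_diff) (auto intro!: int)
  qed
  finally show ?thesis .
qed

lemma set_point_5_1:
  assumes "\<And>i. i < 5 \<Longrightarrow> w i = p" "w 5 = opponent p"
  shows "set_point w 6"
proof -
  have "score w p 5 = (\<Sum>i<5::nat. 1)"
    unfolding score_eq_sum using assms(1) by (intro sum.cong) auto
  then have "score w p (Suc 5) = 5" using assms(2) unfolding score_Suc by simp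
  moreover from this have "score w (opponent p) (Suc 5) = 1" using score_total[of w p "Suc 5"] by simp
  ultimately show ?thesis unfolding set_point_def by auto
qed

text \<open>The witness is a set that starts with five games for A and one for B.\<close>

lemma set_point_prob_pos:
  fixes q :: "nat \<Rightarrow> player pmf"
  assumes "5 < N" and pos: "\<And>i x. i < N \<Longrightarrow> pmf (q i) x > 0"
  defines "M \<equiv> \<Pi>\<^sub>M i\<in>{..<N}. measure_pmf (q i)"
  shows "measure M {g \<in> space M. set_point g 6} > 0"
proof -
  interpret prob_space M unfolding M_def by (intro prob_space_PiM measure_pmf.prob_space_axioms)
  define x where "x i = (if i = 5 then PlayerB else PlayerA)" for i :: nat
  interpret F: finite_product_prob_space "\<lambda>i. measure_pmf (q i)" "{..<N}"
    by unfold_locales simp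
  have "0 < (\<Prod>i<N. pmf (q i) (x i))" using pos by (intro prod_pos) auto
  also have "\<dots> = measure M (\<Pi>\<^sub>E i\<in>{..<N}. {x i})"
    unfolding M_def by (subst F.finite_measure_PiM_emb) (simp_all add: measure_pmf_single)
  also have "\<dots> \<le> measure M {g \<in> space M. set_point g 6}"
  proof (rule finite_measure_mono)
    show "{g \<in> space M. set_point g 6} \<in> events"
      using sets_PiM_pmf[OF _ finite_player, of "{..<N}" q] by (auto simp: M_def space_PiM)
    show "(\<Pi>\<^sub>E i\<in>{..<N}. {x i}) \<subseteq> {g \<in> space M. set_point g 6}"
    proof
      fix g assume g: "g \<in> (\<Pi>\<^sub>E i\<in>{..<N}. {x i})"
      then have "g i = x i" if "i < N" for i using that by (auto simp: PiE_iff)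
      then have "set_point g 6" using assms(1) by (intro set_point_5_1[of g PlayerA]) (auto simp: x_def)
      with g show "g \<in> {g \<in> space M. set_point g 6}" by (auto simp: M_def space_PiM PiE_iff)
    qed
  qed
  finally show ?thesis .
qed

section \<open>The first server has the larger expected game difference\<close>

theorem proposition2p2:
  fixes P :: "player \<Rightarrow> real"
  assumes "P PlayerA \<in> {0<..<1}" and "P PlayerB \<in> {0<..<1}"
    and "game_prob (P PlayerA) + game_prob (P PlayerB) > 1"
  shows "H_set P PlayerA > H_set P PlayerB"
proof -
  let ?q = "\<lambda>i. winner_pmf (game_server PlayerA i) (game_prob (P (game_server PlayerA i)))"
  let ?M = "games_model P PlayerA"
  define p where "p k = measure ?M {g \<in> space ?M. set_point g (2 * k)}" for k
  have G: "0 < game_prob (P s)" "game_prob (P s) < 1" for s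
    using game_prob_bounds[of "P s"] assms(1,2) by (cases s; simp)+
  have q_pos: "pmf (winner_pmf s (game_prob (P s))) x > 0" for s x
    using opponent_cases[of x s] G[of s] by (auto simp: pmf_winner)
  have q: "pmf (?q (2 * k)) PlayerA = game_prob (P PlayerA)"
    "pmf (?q (Suc (2 * k))) PlayerA = 1 - game_prob (P PlayerB)" for k
    using G[of PlayerA] G[of PlayerB] pmf_winner(1)[of "game_prob (P PlayerA)" PlayerA]
      pmf_winner(2)[of "game_prob (P PlayerB)" PlayerB]
    by (simp_all add: game_server_def)
  let ?f = "\<lambda>k g. of_bool (set_point g (2 * k)) *
      (of_bool (g (2 * k) = PlayerA) - of_bool (g (Suc (2 * k)) = PlayerA)) :: real"
  interpret M: prob_space ?M by (rule prob_space_games_model)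
  have "H_set P PlayerA - H_set P PlayerB = (\<integral>g. (\<Sum>k<6. ?f k g) \<partial>?M)"
    using H_set_diff[of P PlayerA] by simp
  also have "\<dots> = (\<Sum>k<6. \<integral>g. ?f k g \<partial>?M)"
  proof (rule Bochner_Integration.integral_sum)
    fix k
    show "integrable ?M (?f k)"
      by (rule M.integrable_const_bound[of _ 1]) (simp_all add: measurable_cong_sets[OF sets_games_model refl])
  qed
  also have "\<dots> = (\<Sum>k<6. p k * (game_prob (P PlayerA) - (1 - game_prob (P PlayerB))))"
  proof (rule sum.cong)
    fix k :: nat assume "k \<in> {..<6}"
    then have "Suc (2 * k) < 12" by simp
    from expectation_set_point[OF this, of ?q]
    show "(\<integral>g. ?f k g \<partial>?M) = p k * (game_prob (P PlayerA) - (1 - game_prob (P PlayerB)))"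
      unfolding q p_def games_model_def .
  qed simp
  also have "\<dots> = (\<Sum>k<6. p k) * (game_prob (P PlayerA) + game_prob (P PlayerB) - 1)"
    by (simp only: sum_distrib_right[symmetric]) simp
  also have "\<dots> > 0"
  proof (rule mult_pos_pos)
    have "p 3 > 0" using set_point_prob_pos[of 12 ?q] q_pos by (simp add: p_def games_model_def)
    moreover have "p k \<ge> 0" for k by (simp add: p_def)
    ultimately show "(\<Sum>k<6. p k) > 0" by (intro sum_pos2[of _ 3]) auto
  qed (use assms(3) in simp)
  finally show ?thesis by simp
qed

end
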